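(* Let $d\ge 1$, $\Omega=(-\pi,\pi)^d$ with periodic boundary conditions, let $\lambda\in[0,1]$ and $0<c_2\le 1$. Consider the exponential Runge--Kutta scheme with time step size $\tau>0$ $$\begin{aligned} U &= u^n + c_2\tau\varphi_1(c_2\tau\lambda\Delta)\Delta u^n,\\ u^{n+1} &= u^n + \tau\varphi_1(\tau\lambda\Delta)\Delta u^n+\frac{\tau}{c_2}\varphi_2(\tau\lambda\Delta)(1-\lambda)\Delta(U-u^n) \end{aligned}$$ for the heat equation $\partial_t u=\lambda\Delta u+(1-\lambda)\Delta u$ on $\Omega$. If $\lambda\ge \frac{1}{1+c_2}$, then this scheme is unconditionally stable.
   Context: The functions $\varphi_1(z)=(\mathrm{e}^z-1)/z$ and $\varphi_2(z)=(\varphi_1(z)-1)/z$, with $\varphi_1(0)=1$, $\varphi_2(0)=1/2$, are entire; functions of $\Delta$ act on periodic functions as Fourier multipliers, $\Delta$ acting on the $\boldsymbol k$-th Fourier mode ($\boldsymbol k\in\mathbb{Z}^d$) as multiplication by $-k^2$, where $k^2=\sum_{\mu=1}^d k_\mu^2$. The scheme therefore acts on each Fourier coefficient $\hat u^n_{\boldsymbol k}$ of $u^n$ by $\hat u^{n+1}_{\boldsymbol k}=\Phi(z,\lambda)\,\hat u^n_{\boldsymbol k}$ with $z=-\tau k^2$, where the stability function $\Phi(z,\lambda)$ is the scalar amplification factor obtained by formally replacing every occurrence of $\tau\Delta$ in the scheme by the real number $z$ and eliminating $U$. The scheme (with parameters $\lambda$, $c_2$) is called unconditionally stable if $|\Phi(z,\lambda)|\le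 1$ for all $z\in(-\infty,0]$. *)

theory Defs
  imports "HOL-Analysis.Analysis"
begin

definition \<phi>\<^sub>1 :: "'a::{real_normed_field,banach} \<Rightarrow> 'a" where
  "\<phi>\<^sub>1 z = (if z = 0 then 1 else (exp z - 1) / z)"

definition \<phi>\<^sub>2 :: "'a::{real_normed_field,banach} \<Rightarrow> 'a" where
  "\<phi>\<^sub>2 z = (if z = 0 then 1 / 2 else (\<phi>\<^sub>1 z - 1) / z)"

definition torus_cell :: "(real ^ 'd) set" where
  "torus_cell = box (\<chi> j. - pi) (\<chi> j. pi)"

text \<open>Periodic functions are taken complex-valued and integrable over one period cell,
  the weakest regularity under which all Fourier coefficients are defined.\<close>

definition torus_fun :: "(real ^ 'd \<Rightarrow> complex) \<Rightarrow> bool" where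
  "torus_fun u \<longleftrightarrow>
     (\<forall>x j. u (x + axis j (2 * pi)) = u x) \<and> set_integrable lebesgue torus_cell u"

definition fourier_coeff :: "(real ^ 'd \<Rightarrow> complex) \<Rightarrow> int ^ 'd \<Rightarrow> complex" where
  "fourier_coeff u k =
     (LINT x:torus_cell|lebesgue. u x * exp (- \<i> * of_real (\<Sum>j\<in>UNIV. of_int (k $ j) * x $ j)))
       / of_real ((2 * pi) ^ CARD('d))"

definition freq_sq :: "int ^ 'd \<Rightarrow> real" where
  "freq_sq k = (\<Sum>j\<in>UNIV. (of_int (k $ j))\<^sup>2)"

text \<open>\<open>laplacian_fun g u w\<close> says \<open>w = g(\<Delta>) u\<close>. It is a relation because \<open>w\<close> is only determined
  up to null sets, and need not exist when \<open>g\<close> is unbounded.\<close>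

definition laplacian_fun ::
  "(real \<Rightarrow> real) \<Rightarrow> (real ^ 'd \<Rightarrow> complex) \<Rightarrow> (real ^ 'd \<Rightarrow> complex) \<Rightarrow> bool" where
  "laplacian_fun g u w \<longleftrightarrow> torus_fun w \<and>
     (\<forall>k. fourier_coeff w k = of_real (g (- freq_sq k)) * fourier_coeff u k)"

text \<open>One step \<open>u \<mapsto> u'\<close> of the scheme with internal stage \<open>U\<close>; in each multiplier the bound
  variable \<open>D\<close> stands for \<open>\<Delta>\<close>.\<close>

definition erk_step ::
  "real \<Rightarrow> real \<Rightarrow> real \<Rightarrow> (real ^ 'd \<Rightarrow> complex) \<Rightarrow> (real ^ 'd \<Rightarrow> complex) \<Rightarrow> bool" where
  "erk_step lam c2 \<tau> u u' \<longleftrightarrow> torus_fun u \<and>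
     (\<exists>U w1 w2 w3.
        laplacian_fun (\<lambda>D. c2 * \<tau> * \<phi>\<^sub>1 (c2 * \<tau> * lam * D) * D) u w1 \<and>
        U = (\<lambda>x. u x + w1 x) \<and>
        laplacian_fun (\<lambda>D. \<tau> * \<phi>\<^sub>1 (\<tau> * lam * D) * D) u w2 \<and>
        laplacian_fun (\<lambda>D. \<tau> / c2 * \<phi>\<^sub>2 (\<tau> * lam * D) * (1 - lam) * D) (\<lambda>x. U x - u x) w3 \<and>
        u' = (\<lambda>x. u x + w2 x + w3 x))"

text \<open>The same two lines with \<open>\<tau>\<Delta>\<close> replaced by the number \<open>z\<close> and \<open>u\<close> by \<open>1\<close>.\<close>

definition stability_fun :: "real \<Rightarrow> real \<Rightarrow> real \<Rightarrow> real" where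
  "stability_fun c2 z lam =
     (let U = 1 + c2 * \<phi>\<^sub>1 (c2 * lam * z) * z
      in 1 + \<phi>\<^sub>1 (lam * z) * z + 1 / c2 * \<phi>\<^sub>2 (lam * z) * (1 - lam) * z * (U - 1))"

definition unconditionally_stable :: "real \<Rightarrow> real \<Rightarrow> bool" where
  "unconditionally_stable lam c2 \<longleftrightarrow> (\<forall>z\<le>0. \<bar>stability_fun c2 z lam\<bar> \<le> 1)"

end

theory Submission imports Defs begin

text \<open>On Fourier coefficients the stage is eliminated by linearity. With \<open>y = - lam * z \<ge> 0\<close> the
  stability function becomes
  \<open>1 - (1 - exp (- y)) / lam + (1 - lam) / (lam\<^sup>2 * c2) * (1 - \<phi>\<^sub>1 (- y)) * (1 - exp (- c2 * y))\<close>.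
  The last term is nonnegative, so the value is at least \<open>1 - 1 / lam \<ge> - c2\<close>. As
  \<open>(1 - lam) / lam \<le> c2\<close>, \<open>0 \<le> \<phi>\<^sub>1 (- y) \<le> 1\<close> and \<open>c2 \<le> 1\<close>, the last term is at most
  \<open>(1 - exp (- y)) / lam\<close>, so the value is at most \<open>1\<close>.\<close>

text \<open>The mode is continuous and has modulus 1, so the product is measurable and dominated by
  \<open>u\<close>. This integrability is what makes Fourier coefficients additive.\<close>

lemma set_integrable_mult_fourier_mode:
  fixes u :: "real ^ 'd \<Rightarrow> complex" and k :: "int ^ 'd"
  assumes "torus_fun u"
  shows "set_integrable lebesgue torus_cell
           (\<lambda>x. u x * exp (- \<i> * of_real (\<Sum>j\<in>UNIV. of_int (k $ j) * x $ j)))"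
proof -
  let ?e = "\<lambda>x::real^'d. exp (- \<i> * of_real (\<Sum>j\<in>UNIV. of_int (k $ j) * x $ j)) :: complex"
  have int: "integrable lebesgue (\<lambda>x. indicat_real torus_cell x *\<^sub>R u x)"
    using assms by (simp add: torus_fun_def set_integrable_def)
  have "continuous_on UNIV ?e"
    by (intro continuous_intros)
  then have "?e \<in> borel_measurable lebesgue"
    by (intro measurable_completion) (simp add: borel_measurable_continuous_onI)
  then have "(\<lambda>x. (indicat_real torus_cell x *\<^sub>R u x) * ?e x) \<in> borel_measurable lebesgue"
    by (intro borel_measurable_times borel_measurable_integrable[OF int])
  then have "integrable lebesgue (\<lambda>x. (indicat_real torus_cell x *\<^sub>R u x) * ?e x)"
    by (rule Bochner_Integration.integrable_bound[OF int]) (simp add: norm_mult)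
  then show ?thesis
    by (simp add: set_integrable_def)
qed

lemma fourier_coeff_add:
  assumes "torus_fun u" and "torus_fun v"
  shows "fourier_coeff (\<lambda>x. u x + v x) k = fourier_coeff u k + fourier_coeff v k"
  unfolding fourier_coeff_def ring_distribs
  by (subst set_integral_add(2)[OF set_integrable_mult_fourier_mode[OF assms(1)]
        set_integrable_mult_fourier_mode[OF assms(2)]]) (simp add: add_divide_distrib)

lemma torus_fun_add:
  assumes "torus_fun u" and "torus_fun v"
  shows "torus_fun (\<lambda>x. u x + v x)"
  using assms by (auto simp: torus_fun_def intro: set_integral_add(1))

lemma fourier_coeff_erk_step:
  assumes "erk_step lam c2 \<tau> u u'"
  shows "fourier_coeff u' k =
           of_real (stability_fun c2 (- \<tau> * freq_sq k) lam) * fourier_coeff u k"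
proof -
  obtain w1 w2 w3 where u: "torus_fun u"
    and w1: "laplacian_fun (\<lambda>D. c2 * \<tau> * \<phi>\<^sub>1 (c2 * \<tau> * lam * D) * D) u w1"
    and w2: "laplacian_fun (\<lambda>D. \<tau> * \<phi>\<^sub>1 (\<tau> * lam * D) * D) u w2"
    \<comment> \<open>Since \<open>U x - u x\<close> is \<open>w1 x\<close>, the stage disappears
      and the coefficient of \<open>w3\<close> carries the product of two multipliers.\<close>
    and w3: "laplacian_fun (\<lambda>D. \<tau> / c2 * \<phi>\<^sub>2 (\<tau> * lam * D) * (1 - lam) * D) w1 w3"
    and u': "u' = (\<lambda>x. u x + w2 x + w3 x)"
    using assms by (auto simp: erk_step_def)
  have "torus_fun w2" "torus_fun w3"
    using w2 w3 by (auto simp: laplacian_fun_def)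
  then have "fourier_coeff u' k = fourier_coeff u k + fourier_coeff w2 k + fourier_coeff w3 k"
    unfolding u' using u by (simp add: fourier_coeff_add torus_fun_add)
  then show ?thesis
    using w1 w2 w3 by (simp add: laplacian_fun_def stability_fun_def Let_def algebra_simps)
qed

text \<open>At \<open>z = 0\<close> both sides vanish, here and in the analogue for
  \<open>\<phi>\<^sub>2\<close>, which spares later case distinctions.\<close>

lemma \<phi>\<^sub>1_mult_self: "\<phi>\<^sub>1 z * z = exp z - 1"
  by (simp add: \<phi>\<^sub>1_def)

lemma \<phi>\<^sub>2_mult_self: "\<phi>\<^sub>2 z * z = \<phi>\<^sub>1 z - 1"
  by (simp add: \<phi>\<^sub>2_def \<phi>\<^sub>1_def)

lemma \<phi>\<^sub>1_nonneg: "0 \<le> \<phi>\<^sub>1 z" for z :: real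
  by (auto simp: \<phi>\<^sub>1_def divide_simps)

lemma \<phi>\<^sub>1_le_1:
  fixes z :: real
  assumes "z \<le> 0"
  shows "\<phi>\<^sub>1 z \<le> 1"
proof -
  have "z \<le> exp z - 1"
    using exp_ge_add_one_self[of z] by linarith
  then show ?thesis
    using assms by (simp add: \<phi>\<^sub>1_def divide_simps)
qed

lemma stability_fun_eq:
  assumes "lam \<noteq> 0"
  shows "stability_fun c2 z lam =
           1 - (1 - exp (lam * z)) / lam
           + (1 - lam) / (lam\<^sup>2 * c2) * ((1 - \<phi>\<^sub>1 (lam * z)) * (1 - exp (c2 * lam * z)))"
proof -
  have "\<phi>\<^sub>1 (lam * z) * z = (exp (lam * z) - 1) / lam"
    using assms \<phi>\<^sub>1_mult_self[of "lam * z"] by (simp add: field_simps)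
  moreover have "c2 * \<phi>\<^sub>1 (c2 * lam * z) * z = (exp (c2 * lam * z) - 1) / lam"
    using assms \<phi>\<^sub>1_mult_self[of "c2 * lam * z"] by (simp add: field_simps)
  moreover have "\<phi>\<^sub>2 (lam * z) * z = (\<phi>\<^sub>1 (lam * z) - 1) / lam"
    using assms \<phi>\<^sub>2_mult_self[of "lam * z"] by (simp add: field_simps)
  \<comment> \<open>The last term contains \<open>z\<close> twice, once explicitly and once in
    \<open>U - 1\<close>; each \<phi>-factor absorbs one of them.\<close>
  moreover have "stability_fun c2 z lam =
      1 + \<phi>\<^sub>1 (lam * z) * z
      + (1 - lam) / c2 * ((\<phi>\<^sub>2 (lam * z) * z) * (c2 * \<phi>\<^sub>1 (c2 * lam * z) * z))"
    by (simp add: stability_fun_def Let_def)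
  ultimately have "stability_fun c2 z lam =
      1 + (exp (lam * z) - 1) / lam
      + (1 - lam) / c2 * ((\<phi>\<^sub>1 (lam * z) - 1) / lam * ((exp (c2 * lam * z) - 1) / lam))"
    by simp
  \<comment> \<open>Both signs are flipped so that each factor is nonnegative when
    \<open>lam * z \<le> 0\<close>.\<close>
  also have "(\<phi>\<^sub>1 (lam * z) - 1) / lam * ((exp (c2 * lam * z) - 1) / lam) =
      (1 - \<phi>\<^sub>1 (lam * z)) * (1 - exp (c2 * lam * z)) / lam\<^sup>2"
    by (simp add: power2_eq_square algebra_simps)
  also have "1 + (exp (lam * z) - 1) / lam = 1 - (1 - exp (lam * z)) / lam"
    by (simp add: diff_divide_distrib)
  finally show ?thesis
    by (simp add: mult_ac)
qed

lemma abs_stability_fun_le_1: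
  assumes "lam \<le> 1" and "0 < c2" and "c2 \<le> 1" and "1 / (1 + c2) \<le> lam" and "z \<le> 0"
  shows "\<bar>stability_fun c2 z lam\<bar> \<le> 1"
proof -
  have "0 < 1 / (1 + c2)"
    using assms(2) by simp
  then have lam: "0 < lam"
    using assms(4) by linarith
  have c2: "1 \<le> lam * (1 + c2)"
    using assms(2,4) by (simp add: pos_divide_le_eq)
  have w: "lam * z \<le> 0"
    using lam assms(5) by (simp add: mult_nonneg_nonpos)
  define p where "p = 1 - \<phi>\<^sub>1 (lam * z)"
  define a where "a = 1 - exp (lam * z)"
  define b where "b = 1 - exp (c2 * lam * z)"
  have p: "0 \<le> p" "p \<le> 1"
    using \<phi>\<^sub>1_nonneg[of "lam * z"] \<phi>\<^sub>1_le_1[OF w] by (auto simp: p_def)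
  have a: "a \<le> 1"
    by (simp add: a_def)
  \<comment> \<open>As \<open>c2 \<le> 1\<close> and \<open>lam * z \<le> 0\<close>, the exponents
    satisfy \<open>lam * z \<le> c2 * lam * z \<le> 0\<close>.\<close>
  have b: "0 \<le> b" "b \<le> a"
    using assms(2,3) w mult_right_mono_neg[of c2 1 "lam * z"]
    by (auto simp: a_def b_def mult.assoc mult_nonneg_nonpos)
  have pb: "0 \<le> p * b" "p * b \<le> a"
    using p b mult_mono[of p 1 b a] by auto
  \<comment> \<open>The upper bound is \<open>1 - lam \<le> lam * c2\<close>, a rearrangement of the
    hypothesis on \<open>lam\<close>, with denominators cleared.\<close>
  have coeff: "0 \<le> (1 - lam) / (lam\<^sup>2 * c2)" "(1 - lam) / (lam\<^sup>2 * c2) \<le> 1 / lam"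
    using assms(1,2) lam c2 mult_left_mono[OF c2, of lam]
    by (auto simp: divide_simps power2_eq_square algebra_simps)
  have "(1 - lam) / (lam\<^sup>2 * c2) * (p * b) \<le> 1 / lam * a"
    using coeff pb lam by (intro mult_mono) auto
  moreover have "0 \<le> (1 - lam) / (lam\<^sup>2 * c2) * (p * b)"
    using coeff(1) pb(1) by (rule mult_nonneg_nonneg)
  \<comment> \<open>This gives the lower bound -1: \<open>c2 \<le> 1\<close> forces
    \<open>lam \<ge> 1 / 2\<close>, and \<open>a \<le> 1\<close>.\<close>
  moreover have "a / lam \<le> 2"
  proof -
    have "lam * c2 \<le> lam"
      using lam assms(3) by simp
    then have "1 \<le> 2 * lam"
      using c2 unfolding distrib_left by linarith
    then show ?thesis
      using lam a by (simp add: pos_divide_le_eq)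
  qed
  moreover have "stability_fun c2 z lam = 1 - a / lam + (1 - lam) / (lam\<^sup>2 * c2) * (p * b)"
    using lam by (simp add: stability_fun_eq a_def b_def p_def)
  ultimately show ?thesis
    by simp
qed

theorem theorem2p4:
  fixes lam c2 :: real
  assumes "0 \<le> lam" and "lam \<le> 1" and "0 < c2" and "c2 \<le> 1"
    and "lam \<ge> 1 / (1 + c2)"
  shows "(\<forall>\<tau>>0. \<forall>(u :: real ^ 'd \<Rightarrow> complex) u'. erk_step lam c2 \<tau> u u' \<longrightarrow>
             (\<forall>k. fourier_coeff u' k =
                   of_real (stability_fun c2 (- \<tau> * freq_sq k) lam) * fourier_coeff u k))
         \<and> unconditionally_stable lam c2"
  using assms fourier_coeff_erk_step abs_stability_fun_le_1
  unfolding unconditionally_stable_def by blast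

end
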